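(* Let $\phi:[0,\infty)\to[0,\infty)$ be an increasing convex function such that the measure $\mu(A)=\int_A e^{-\phi(|x|)}\,dx$ on $\mathbb{R}^n$ is a probability measure (a rotation invariant log-concave probability measure with non-constant density). Let $K\subset\mathbb{R}^n$ be a convex symmetric body and let $R>0$ be such that, for all sufficiently large $t$, $$\mu(tRB_2^n)\le\mu(tK).$$ Then $RB_2^n\subseteq K$.
   Context: $|x|$ is the Euclidean norm on $\mathbb{R}^n$ and $B_2^n$ is the closed Euclidean unit ball. A convex body is a convex compact set with nonempty interior; it is symmetric if $K=-K$. For $t>0$, $tA=\{ta:a\in A\}$. "Increasing" is understood as non-decreasing (the function $\phi$ may be constant on an initial interval $[0,t_0]$, but it is not constant on $[0,\infty)$). *)

theory Defs
  imports "HOL-Probability.Probability"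
begin

definition convex_body :: "'a::euclidean_space set \<Rightarrow> bool" where
  "convex_body K \<longleftrightarrow> convex K \<and> compact K \<and> interior K \<noteq> {}"

definition symmetric_set :: "'a::euclidean_space set \<Rightarrow> bool" where
  "symmetric_set K \<longleftrightarrow> K = uminus ` K"

definition dilate :: "real \<Rightarrow> 'a::euclidean_space set \<Rightarrow> 'a set" where
  "dilate t A = (\<lambda>a. t *\<^sub>R a) ` A"

text \<open>Only the values of \<phi> on the half-line from 0 to infinity matter, since the norm is
  nonnegative.\<close>

definition radial_measure :: "(real \<Rightarrow> real) \<Rightarrow> 'a::euclidean_space measure" where
  "radial_measure \<phi> = density lborel (\<lambda>x. ennreal (exp (- \<phi> (norm x))))"

end

theory Submission
  imports Defs
begin

text \<open>If a point of \<open>R B\<close> lies outside \<open>K\<close>, then \<open>K\<close> lies in a half-space \<open>\<theta> \<bullet> y < w\<close> with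
  \<open>|\<theta>| = 1\<close> and \<open>0 < w < R\<close>, so for large \<open>t\<close> the half-space \<open>\<theta> \<bullet> y > t w\<close> has at most the measure of
  \<open>|y| > t R\<close>. For \<open>w < a < R\<close>, compactness of the sphere covers \<open>|y| > t a\<close> by \<open>N\<close> rotated copies
  of this half-space, with \<open>N\<close> independent of \<open>t\<close>, so \<open>|y| > t a\<close> has at most \<open>N\<close> times the measure
  of \<open>|y| > t R\<close>. But \<open>\<phi> (s u) - \<phi> u\<close> tends to infinity for \<open>s = R / a > 1\<close>, so by scaling
  the ratio of the measures of \<open>|y| > t R\<close> and \<open>|y| > t a\<close> tends to 0.\<close>

section \<open>Growth of convex functions\<close>

text \<open>The point \<open>u\<close> is a convex combination of 0 and \<open>s * u\<close>, with
  weight \<open>1 / s\<close> on the latter.\<close>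

lemma convex_on_scale_diff_ge:
  fixes f :: "real \<Rightarrow> real"
  assumes "convex_on {0..} f" "0 \<le> u" "1 \<le> s"
  shows "s * (f u - f 0) \<le> f (s * u) - f 0"
proof -
  have "f ((1 - 1 / s) *\<^sub>R 0 + (1 / s) *\<^sub>R (s * u)) \<le> (1 - 1 / s) * f 0 + (1 / s) * f (s * u)"
    using assms by (intro convex_onD[OF assms(1)]) auto
  then show ?thesis
    using assms(3) by (simp add: field_simps)
qed

text \<open>Beyond a point \<open>x\<close> with \<open>f x > f 0\<close>, convexity makes
  \<open>f u - f 0\<close> grow at least linearly, and \<open>f (s * u) - f u\<close> is at least
  \<open>s - 1\<close> times this difference.\<close>

lemma convex_mono_growth:
  fixes f :: "real \<Rightarrow> real"
  assumes "convex_on {0..} f" "mono_on {0..} f" "\<not> f constant_on {0..}" "1 < s"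
  obtains u0 where "0 < u0" "\<And>u. u0 \<le> u \<Longrightarrow> M \<le> f (s * u) - f u"
proof -
  obtain x where x: "0 \<le> x" "f x \<noteq> f 0"
    using assms(3) unfolding constant_on_def by auto
  then have "0 < x" "f 0 < f x"
    using mono_onD[OF assms(2), of 0 x] by (cases "x = 0"; force)+
  define c where "c = (s - 1) * (f x - f 0) / x"
  have "0 < c"
    using \<open>0 < x\<close> \<open>f 0 < f x\<close> assms(4) by (simp add: c_def)
  show thesis
  proof (rule that[of "max x (M / c)"])
    show "0 < max x (M / c)"
      using \<open>0 < x\<close> by auto
    fix u assume u: "max x (M / c) \<le> u"
    have "(u / x) * (f x - f 0) \<le> f ((u / x) * x) - f 0"
      using u \<open>0 < x\<close> by (intro convex_on_scale_diff_ge[OF assms(1)]) auto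
    then have "(u / x) * (f x - f 0) \<le> f u - f 0"
      using \<open>0 < x\<close> by simp
    then have "(s - 1) * ((u / x) * (f x - f 0)) \<le> (s - 1) * (f u - f 0)"
      using assms(4) by (intro mult_left_mono) auto
    moreover have "(s - 1) * ((u / x) * (f x - f 0)) = c * u"
      by (simp add: c_def)
    moreover have "s * (f u - f 0) \<le> f (s * u) - f 0"
      using u \<open>0 < x\<close> assms(4) by (intro convex_on_scale_diff_ge[OF assms(1)]) auto
    moreover have "M \<le> c * u"
      using u \<open>0 < c\<close> by (simp add: field_simps)
    ultimately show "M \<le> f (s * u) - f u"
      by (simp add: algebra_simps)
  qed
qed

section \<open>Measurability and rotation invariance of Lebesgue measure\<close>

text \<open>Precomposing with \<open>max 0\<close> gives a function that is monotone on the whole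
  line and agrees with \<open>f\<close> on norms.\<close>

lemma borel_measurable_norm_mono_on:
  fixes f :: "real \<Rightarrow> real"
  assumes "mono_on {0..} f"
  shows "(\<lambda>x::'a::euclidean_space. f (norm x)) \<in> borel_measurable borel"
proof -
  have "mono (\<lambda>r. f (max 0 r))"
    by (intro monoI mono_onD[OF assms]) auto
  then have "(\<lambda>r. f (max 0 r)) \<in> borel_measurable borel"
    by (rule borel_measurable_mono)
  then have "(\<lambda>x::'a. f (max 0 (norm x))) \<in> borel_measurable borel"
    by (rule measurable_compose[rotated]) simp
  then show ?thesis
    by simp
qed

lemma borel_measurable_orthogonal_transformation:
  fixes T :: "'a::euclidean_space \<Rightarrow> 'a"
  assumes "orthogonal_transformation T"
  shows "T \<in> borel_measurable borel"
  using assms by (intro borel_measurable_continuous_onI linear_continuous_on)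
    (simp add: linear_linear orthogonal_transformation_linear)

text \<open>The Jacobian is 1. The cases \<open>c = 1\<close> and \<open>c = - 1\<close> are the
  translations and reflections of the uniqueness argument below.\<close>

lemma nn_integral_lborel_isometric_affine:
  fixes g :: "'a::euclidean_space \<Rightarrow> ennreal"
  assumes [measurable]: "g \<in> borel_measurable borel" and "\<bar>c\<bar> = 1"
  shows "(\<integral>\<^sup>+x. g x \<partial>lborel) = (\<integral>\<^sup>+x. g (t + c *\<^sub>R x) \<partial>lborel)"
proof -
  have "c \<noteq> 0"
    using assms(2) by auto
  then show ?thesis
    using assms(2)
    by (subst lborel_affine[of c t]) (simp_all add: nn_integral_density nn_integral_distr)
qed

text \<open>The uniqueness argument for translation invariant measures: integrate
  \<open>1\<^sub>A (T x) 1\<^sub>B (T x + y)\<close> over \<open>x\<close> and \<open>y\<close> in both orders, with \<open>B\<close> the unit ball, which \<open>T\<close> preserves.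
  The library's \<open>measure_orthogonal_image\<close> requires a well-ordered index type.\<close>

lemma lborel_distr_orthogonal:
  fixes T :: "'a::euclidean_space \<Rightarrow> 'a"
  assumes T: "orthogonal_transformation T"
  shows "distr lborel borel T = lborel"
proof (rule measure_eqI)
  note [measurable] = borel_measurable_orthogonal_transformation[OF T]
  have lin: "linear T" "bij T"
    using T by (simp_all add: orthogonal_transformation_linear orthogonal_transformation_bij)
  define B where "B = ball (0::'a) 1"
  have [measurable]: "B \<in> sets borel"
    by (simp add: B_def)
  have TB: "indicator B (T x) = (indicator B x :: ennreal)" for x
    using T by (simp add: B_def indicator_def orthogonal_transformation_norm)
  fix A :: "'a set" assume "A \<in> sets (distr lborel borel T)"
  then have [measurable]: "A \<in> sets borel" by simp
  have "emeasure (distr lborel borel T) A * emeasure lborel B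
    = (\<integral>\<^sup>+x. indicator A (T x) \<partial>lborel) * (\<integral>\<^sup>+y. indicator B y \<partial>lborel)"
    by (simp add: nn_integral_distr flip: nn_integral_indicator)
  also have "\<dots> = (\<integral>\<^sup>+x. indicator A (T x) * (\<integral>\<^sup>+y. indicator B y \<partial>lborel) \<partial>lborel)"
    by (subst nn_integral_multc) auto
  also have "\<dots> = (\<integral>\<^sup>+x. indicator A (T x) * (\<integral>\<^sup>+y. indicator B (T x + 1 *\<^sub>R y) \<partial>lborel) \<partial>lborel)"
  proof (rule nn_integral_cong)
    fix x
    have "(\<integral>\<^sup>+y. indicator B y \<partial>lborel) = (\<integral>\<^sup>+y. indicator B (T x + 1 *\<^sub>R y) \<partial>lborel)"
      by (rule nn_integral_lborel_isometric_affine) auto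
    then show "indicator A (T x) * (\<integral>\<^sup>+y. indicator B y \<partial>lborel)
        = indicator A (T x) * (\<integral>\<^sup>+y. indicator B (T x + 1 *\<^sub>R y) \<partial>lborel)"
      by (rule arg_cong)
  qed
  also have "\<dots> = (\<integral>\<^sup>+x. (\<integral>\<^sup>+y. indicator A (T x) * indicator B (T x + y) \<partial>lborel) \<partial>lborel)"
    by (simp add: nn_integral_cmult)
  also have "\<dots> = (\<integral>\<^sup>+y. (\<integral>\<^sup>+x. indicator A (T x) * indicator B (T x + y) \<partial>lborel) \<partial>lborel)"
    by (intro lborel_pair.Fubini') measurable
  also have "\<dots> = (\<integral>\<^sup>+y. (\<integral>\<^sup>+x. indicator A (T x - y) * indicator B (T x) \<partial>lborel) \<partial>lborel)"
  proof (rule nn_integral_cong)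
    fix y
    \<comment> \<open>Translating \<open>x\<close> by \<open>- inv T y\<close> cancels
      \<open>y\<close> in the argument of \<open>B\<close> and shifts the argument of
      \<open>A\<close> instead.\<close>
    have "T (- inv T y + 1 *\<^sub>R x) = T x - y" for x
      using lin by (simp add: linear_add linear_neg surj_f_inv_f bij_is_surj linear_diff)
    then show "(\<integral>\<^sup>+x. indicator A (T x) * indicator B (T x + y) \<partial>lborel)
        = (\<integral>\<^sup>+x. indicator A (T x - y) * indicator B (T x) \<partial>lborel)"
      by (subst nn_integral_lborel_isometric_affine[where c = 1 and t = "- inv T y"]) auto
  qed
  also have "\<dots> = (\<integral>\<^sup>+x. (\<integral>\<^sup>+y. indicator B (T x) * indicator A (T x - y) \<partial>lborel) \<partial>lborel)"
    by (subst lborel_pair.Fubini') (auto simp: mult.commute)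
  also have "\<dots> = (\<integral>\<^sup>+x. indicator B x * (\<integral>\<^sup>+y. indicator A (T x + (- 1) *\<^sub>R y) \<partial>lborel) \<partial>lborel)"
    by (simp add: nn_integral_cmult TB)
  also have "\<dots> = (\<integral>\<^sup>+x. indicator B x * emeasure lborel A \<partial>lborel)"
    by (subst nn_integral_lborel_isometric_affine[symmetric, where c = "- 1"]) auto
  also have "\<dots> = emeasure lborel A * emeasure lborel B"
    by (simp add: nn_integral_multc mult.commute)
  finally have "emeasure (distr lborel borel T) A * emeasure lborel B
    = emeasure lborel A * emeasure lborel B" .
  moreover have "emeasure lborel B \<noteq> 0" "emeasure lborel B \<noteq> \<infinity>"
    by (simp_all add: B_def emeasure_ball unit_ball_vol_pos less_imp_neq[THEN not_sym])
  ultimately show "emeasure (distr lborel borel T) A = emeasure lborel A"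
    by (simp add: mult.commute[of _ "emeasure lborel B"] ennreal_mult_cancel_left)
qed simp

section \<open>Half-spaces and tails under the radial measure\<close>

lemma sets_radial_measure [simp, measurable_cong]: "sets (radial_measure f) = sets borel"
  by (simp add: radial_measure_def)

lemma space_radial_measure [simp]: "space (radial_measure f) = UNIV"
  by (simp add: radial_measure_def)

lemma emeasure_radial_measure:
  fixes A :: "'a::euclidean_space set"
  assumes "mono_on {0..} f" "A \<in> sets borel"
  shows "emeasure (radial_measure f) A
    = (\<integral>\<^sup>+x. ennreal (exp (- f (norm x))) * indicator A x \<partial>lborel)"
proof -
  note [measurable] = borel_measurable_norm_mono_on[OF assms(1), where 'a = 'a]
  show ?thesis
    unfolding radial_measure_def using assms(2) by (intro emeasure_density) auto
qed

text \<open>The density is invariant because \<open>T\<close> preserves norms, and Lebesgue measure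
  is its own push-forward under \<open>T\<close>.\<close>

lemma emeasure_radial_measure_orthogonal:
  fixes T :: "real ^ 'n \<Rightarrow> real ^ 'n"
  assumes "mono_on {0..} f" "orthogonal_transformation T" "A \<in> sets borel"
  shows "emeasure (radial_measure f) (T -` A) = emeasure (radial_measure f) A"
proof -
  note [measurable] = borel_measurable_norm_mono_on[OF assms(1), where 'a = "real ^ 'n"]
  note T [measurable] = borel_measurable_orthogonal_transformation[OF assms(2)]
  have [measurable]: "A \<in> sets borel" "T -` A \<in> sets borel"
    using assms(3) measurable_sets[OF T, of A] by simp_all
  have "emeasure (radial_measure f) A
    = (\<integral>\<^sup>+x. ennreal (exp (- f (norm x))) * indicator A x \<partial>distr lborel borel T)"
    using assms by (simp add: emeasure_radial_measure lborel_distr_orthogonal)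
  also have "\<dots> = (\<integral>\<^sup>+x. ennreal (exp (- f (norm (T x)))) * indicator A (T x) \<partial>lborel)"
    by (intro nn_integral_distr) auto
  also have "\<dots> = emeasure (radial_measure f) (T -` A)"
    using assms(1,2) by (simp add: emeasure_radial_measure orthogonal_transformation_norm
        indicator_vimage[unfolded comp_def])
  finally show ?thesis by simp
qed

text \<open>An orthogonal map taking \<open>v\<close> to \<open>w\<close> pulls the second
  half-space back to the first.\<close>

lemma emeasure_radial_measure_halfspace:
  fixes v w :: "real ^ 'n"
  assumes "mono_on {0..} f" "norm v = norm w"
  shows "emeasure (radial_measure f) {x. c < v \<bullet> x} = emeasure (radial_measure f) {x. c < w \<bullet> x}"
proof -
  obtain T where T: "orthogonal_transformation T" "T v = w"
    using orthogonal_transformation_exists[OF assms(2)] by blast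
  then have "T -` {x. c < w \<bullet> x} = {x. c < v \<bullet> x}"
    by (auto simp: orthogonal_transformation_def)
  then show ?thesis
    using emeasure_radial_measure_orthogonal[OF assms(1) T(1), of "{x. c < w \<bullet> x}"] by simp
qed

text \<open>A strictly positive density charges every nonempty open set. This excludes the
  degenerate case in which the tails compared at the end all vanish.\<close>

lemma emeasure_radial_measure_tail_pos:
  assumes "mono_on {0..} f"
  shows "0 < emeasure (radial_measure f) {x::'a::euclidean_space. r < norm x}"
proof -
  note [measurable] = borel_measurable_norm_mono_on[OF assms, where 'a = 'a]
  let ?A = "{x::'a. r < norm x}"
  obtain x :: 'a where "norm x = max 0 (r + 1)"
    using vector_choose_size[of "max 0 (r + 1)"] by auto
  then have "x \<in> ?A"
    by simp
  moreover have "open ?A"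
    by (intro open_Collect_less continuous_on_const continuous_on_norm_id)
  ultimately have A: "open ?A" "?A \<noteq> {}"
    by blast+
  have [measurable]: "?A \<in> sets borel"
    using A(1) by auto
  show ?thesis
  proof (rule ccontr)
    assume "\<not> ?thesis"
    then have "(\<integral>\<^sup>+x. ennreal (exp (- f (norm x))) * indicator ?A x \<partial>lborel) = 0"
      using assms by (simp add: emeasure_radial_measure)
    then have "AE x in lborel. ennreal (exp (- f (norm x))) * indicator ?A x = 0"
      by (subst (asm) nn_integral_0_iff_AE) auto
    then have "AE x in lborel. x \<notin> ?A"
      by eventually_elim (auto simp: indicator_def split: if_splits)
    then have "emeasure lborel ?A = 0"
      using AE_iff_measurable[of ?A lborel "\<lambda>x. x \<notin> ?A"] by auto
    then have "?A \<in> null_sets lebesgue"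
      by (auto simp: null_sets_def)
    then show False
      using A open_not_negligible[of ?A] by (simp add: negligible_iff_null_sets)
  qed
qed

text \<open>Substituting \<open>s *\<^sub>R x\<close> for \<open>x\<close> costs the Jacobian
  \<open>s ^ DIM('a)\<close>, while the growth of \<open>f\<close> gains \<open>exp (- M)\<close>
  pointwise.\<close>

lemma emeasure_radial_measure_tail_scale:
  fixes f :: "real \<Rightarrow> real"
  assumes "mono_on {0..} f" "0 < s" "\<And>u. r \<le> u \<Longrightarrow> M \<le> f (s * u) - f u"
  shows "emeasure (radial_measure f) {x::'a::euclidean_space. s * r < norm x}
    \<le> ennreal (s ^ DIM('a) * exp (- M)) * emeasure (radial_measure f) {x::'a. r < norm x}"
proof -
  note [measurable] = borel_measurable_norm_mono_on[OF assms(1), where 'a = 'a]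
  have "emeasure (radial_measure f) {x::'a. s * r < norm x}
    = (\<integral>\<^sup>+x. ennreal (exp (- f (norm x))) * indicator {x. s * r < norm x} (x::'a) \<partial>lborel)"
    using assms(1) by (simp add: emeasure_radial_measure)
  also have "\<dots> = (\<integral>\<^sup>+x. ennreal (s ^ DIM('a)) * (ennreal (exp (- f (norm (s *\<^sub>R x)))) *
      indicator {x. s * r < norm x} (s *\<^sub>R x::'a)) \<partial>lborel)"
    using assms(2)
    by (subst lborel_affine[of s 0]) (auto simp: nn_integral_density nn_integral_distr)
  also have "\<dots> \<le> (\<integral>\<^sup>+x. ennreal (s ^ DIM('a) * exp (- M)) *
      (ennreal (exp (- f (norm x))) * indicator {x. r < norm x} (x::'a)) \<partial>lborel)"
  proof (intro nn_integral_mono)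
    fix x :: 'a
    show "ennreal (s ^ DIM('a)) * (ennreal (exp (- f (norm (s *\<^sub>R x)))) *
        indicator {x. s * r < norm x} (s *\<^sub>R x))
      \<le> ennreal (s ^ DIM('a) * exp (- M)) *
        (ennreal (exp (- f (norm x))) * indicator {x. r < norm x} x)"
    proof (cases "r < norm x")
      case True
      have "exp (- f (s * norm x)) \<le> exp (- M) * exp (- f (norm x))"
        using assms(3)[of "norm x"] True by (simp flip: exp_add)
      then have "s ^ DIM('a) * exp (- f (s * norm x))
          \<le> s ^ DIM('a) * exp (- M) * exp (- f (norm x))"
        using assms(2) by (simp add: mult.assoc)
      then show ?thesis
        using True assms(2) by (simp flip: ennreal_mult)
    qed (use assms(2) in auto)
  qed
  also have "\<dots> = ennreal (s ^ DIM('a) * exp (- M)) * emeasure (radial_measure f) {x::'a. r < norm x}"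
    using assms(1) by (simp add: emeasure_radial_measure nn_integral_cmult)
  finally show ?thesis .
qed

section \<open>Covering tails by half-spaces and separating a point from the body\<close>

text \<open>A point \<open>x\<close> of the sphere of radius \<open>a\<close> lies in the half-space
  with unit normal \<open>x /\<^sub>R a\<close>, whose product with \<open>x\<close> is
  \<open>a > w\<close>. Compactness selects finitely many normals, and homogeneity makes them serve
  every \<open>t\<close>.\<close>

lemma tail_subset_halfspaces:
  fixes w a :: real
  assumes "0 < w" "w < a"
  obtains F :: "'a::euclidean_space set" where "finite F" "F \<subseteq> sphere 0 1"
    "\<And>t. 0 < t \<Longrightarrow> {x. t * a < norm x} \<subseteq> (\<Union>v\<in>F. {x. t * w < v \<bullet> x})"
proof -
  have cover: "sphere 0 a \<subseteq> (\<Union>v\<in>sphere (0::'a) 1. {x. w < v \<bullet> x})"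
  proof
    fix x :: 'a assume "x \<in> sphere 0 a"
    then have "x /\<^sub>R a \<in> sphere 0 1" "w < (x /\<^sub>R a) \<bullet> x"
      using assms by (auto simp: dot_square_norm power2_eq_square field_simps)
    then show "x \<in> (\<Union>v\<in>sphere (0::'a) 1. {x. w < v \<bullet> x})"
      by blast
  qed
  obtain F where F: "F \<subseteq> sphere (0::'a) 1" "finite F" "sphere 0 a \<subseteq> (\<Union>v\<in>F. {x. w < v \<bullet> x})"
    by (rule compactE_image[OF compact_sphere _ cover]) (auto simp: open_halfspace_gt)
  show thesis
  proof (rule that[OF F(2,1)])
    fix t :: real assume t: "0 < t"
    show "{x. t * a < norm x} \<subseteq> (\<Union>v\<in>F. {x. t * w < v \<bullet> x})"
    proof clarify
      fix x :: 'a assume x: "t * a < norm x"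
      then have "0 < norm x"
        using t assms by (smt (verit) mult_pos_pos)
      then have "(a / norm x) *\<^sub>R x \<in> sphere 0 a"
        using assms by simp
      then obtain v where v: "v \<in> F" "w < v \<bullet> ((a / norm x) *\<^sub>R x)"
        using F(3) by blast
      \<comment> \<open>As \<open>x\<close> is longer than \<open>t * a\<close>, scaling back from
        the sphere of radius \<open>a\<close> gains at least the factor \<open>t\<close>.\<close>
      have "t * w * a \<le> w * norm x"
        using x assms by (simp add: mult.commute mult.left_commute)
      also have "\<dots> < a * (v \<bullet> x)"
        using v(2) \<open>0 < norm x\<close> by (simp add: field_simps)
      finally have "t * w < v \<bullet> x"
        using assms by (simp add: mult.commute)
      then show "x \<in> (\<Union>v\<in>F. {x. t * w < v \<bullet> x})"
        using v(1) by auto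
    qed
  qed
qed

text \<open>Symmetry puts 0, the midpoint of \<open>y\<close> and \<open>- y\<close>, in
  \<open>K\<close>, so the offset of a separating hyperplane is nonzero and \<open>w\<close> can be
  positive. Cauchy-Schwarz gives \<open>w < norm x\<close>.\<close>

lemma symmetric_convex_separation:
  fixes K :: "'a::euclidean_space set"
  assumes "convex_body K" "symmetric_set K" "x \<notin> K"
  obtains v w where "norm v = 1" "0 < w" "w < norm x" "\<And>y. y \<in> K \<Longrightarrow> v \<bullet> y < w"
proof -
  have K: "convex K" "closed K" "K \<noteq> {}"
    using assms(1) interior_subset by (auto simp: convex_body_def compact_imp_closed)
  then obtain y where "y \<in> K" by auto
  then have "- y \<in> K"
    using assms(2) unfolding symmetric_set_def by blast
  then have "0 \<in> K"
    using convexD[OF K(1) \<open>y \<in> K\<close>, of "- y" "1/2" "1/2"] by simp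
  obtain p b where p: "p \<bullet> x < b" "\<And>y. y \<in> K \<Longrightarrow> b < p \<bullet> y"
    using separating_hyperplane_closed_point[OF K(1,2) assms(3)] by auto
  then have "b < 0"
    using \<open>0 \<in> K\<close> by force
  then have "p \<noteq> 0"
    using p(1) by auto
  have "\<bar>p \<bullet> x\<bar> \<le> norm p * norm x"
    by (rule Cauchy_Schwarz_ineq2)
  with p(1) have "- b < norm p * norm x"
    by linarith
  show thesis
  proof (rule that[of "- (p /\<^sub>R norm p)" "- b / norm p"])
    show "- b / norm p < norm x"
      using \<open>- b < norm p * norm x\<close> \<open>p \<noteq> 0\<close> by (simp add: field_simps)
    show "- (p /\<^sub>R norm p) \<bullet> y < - b / norm p" if "y \<in> K" for y
      using p(2)[OF that] \<open>p \<noteq> 0\<close> by (simp add: field_simps)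
  qed (use \<open>p \<noteq> 0\<close> \<open>b < 0\<close> in \<open>auto simp: field_simps\<close>)
qed

lemma dilate_cball:
  assumes "0 < r"
  shows "dilate r (cball 0 1) = (cball 0 r :: 'a::euclidean_space set)"
  using cball_scale[of r 0 1] assms by (simp add: dilate_def image_image)

theorem theorem1:
  fixes \<phi> :: "real \<Rightarrow> real" and \<mu> :: "(real ^ 'n) measure"
    and K :: "(real ^ 'n) set" and R :: real
  assumes nonneg: "\<And>r. 0 \<le> r \<Longrightarrow> 0 \<le> \<phi> r"
    and increasing: "mono_on {0..} \<phi>"
    and convex: "convex_on {0..} \<phi>"
    and nonconstant: "\<not> \<phi> constant_on {0..}"
    and mu: "\<mu> = radial_measure \<phi>"
    and prob: "prob_space \<mu>"
    and body: "convex_body K" and symmetric: "symmetric_set K"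
    and R_pos: "0 < R"
    and large_t: "\<forall>\<^sub>F t in at_top.
      measure \<mu> (dilate (t * R) (cball 0 1)) \<le> measure \<mu> (dilate t K)"
  shows "dilate R (cball 0 1) \<subseteq> K"
proof (rule ccontr)
  interpret prob_space \<mu> by (rule prob)
  have [simp]: "sets \<mu> = sets borel" "space \<mu> = UNIV"
    by (simp_all add: mu)
  assume "\<not> dilate R (cball 0 1) \<subseteq> K"
  then obtain x where x: "norm x \<le> R" "x \<notin> K"
    unfolding dilate_cball[OF R_pos] by (meson mem_cball_0 subsetI)
  obtain v w where vw: "norm v = 1" "0 < w" "w < norm x" "\<And>y. y \<in> K \<Longrightarrow> v \<bullet> y < w"
    using symmetric_convex_separation[OF body symmetric x(2)] by blast
  \<comment> \<open>The gap below \<open>a\<close> allows the finite cover; the gap above makes the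
    ratio \<open>s\<close> exceed 1.\<close>
  obtain a where a: "w < a" "a < R"
    using vw(3) x(1) dense[of w R] by auto
  obtain F :: "(real ^ 'n) set" where F: "finite F" "F \<subseteq> sphere 0 1"
    "\<And>t. 0 < t \<Longrightarrow> {x. t * a < norm x} \<subseteq> (\<Union>v\<in>F. {x. t * w < v \<bullet> x})"
    using tail_subset_halfspaces[OF vw(2) a(1)] by blast
  define s where "s = R / a"
  have s: "1 < s" "s * a = R"
    using a vw(2) by (auto simp: s_def)
  \<comment> \<open>With \<open>M = ln C\<close> the tail estimate has factor exactly
    \<open>1 / (card F + 1)\<close>: the power of \<open>s\<close> absorbs the Jacobian, and the
    extra 1 beats the \<open>card F\<close> half-spaces.\<close>
  define C where "C = s ^ DIM(real ^ 'n) * (real (card F) + 1)"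
  have "0 < C"
    using s(1) by (simp add: C_def)
  obtain u0 where u0: "0 < u0" "\<And>u. u0 \<le> u \<Longrightarrow> ln C \<le> \<phi> (s * u) - \<phi> u"
    using convex_mono_growth[OF convex increasing nonconstant s(1)] by blast
  \<comment> \<open>A single \<open>t\<close> suffices, large enough that the growth bound holds
    from radius \<open>t * a\<close> on.\<close>
  have "\<forall>\<^sub>F t in at_top. u0 / a \<le> t"
    by (rule eventually_ge_at_top)
  with large_t have "\<forall>\<^sub>F t in at_top.
      measure \<mu> (dilate (t * R) (cball 0 1)) \<le> measure \<mu> (dilate t K) \<and> u0 / a \<le> t"
    by (rule eventually_conj)
  then obtain t where t: "measure \<mu> (dilate (t * R) (cball 0 1)) \<le> measure \<mu> (dilate t K)"
      "u0 / a \<le> t"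
    using eventually_happens'[OF trivial_limit_at_top_linorder] by blast
  have "0 < a" using a vw(2) by simp
  then have "0 < u0 / a" "u0 \<le> t * a"
    using u0(1) t(2) by (auto simp: field_simps)
  then have "0 < t"
    using t(2) by simp
  let ?H = "\<lambda>v. {x. t * w < v \<bullet> x}" and ?T = "\<lambda>r. {x::real ^ 'n. t * r < norm x}"
  \<comment> \<open>The dilate of \<open>K\<close> misses the half-space and the ball is the
    complement of a tail, so complements reverse the assumed inequality.\<close>
  have "dilate t K \<subseteq> - ?H v"
    using vw(4) \<open>0 < t\<close> by (force simp: dilate_def)
  then have "measure \<mu> (dilate t K) \<le> measure \<mu> (- ?H v)"
    by (intro finite_measure_mono) auto
  moreover have "measure \<mu> (- ?H v) = 1 - measure \<mu> (?H v)"
    using prob_compl[of "?H v"] by (simp add: Compl_eq_Diff_UNIV)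
  moreover have "dilate (t * R) (cball 0 1) = UNIV - ?T R"
    using \<open>0 < t\<close> R_pos by (auto simp: dilate_cball)
  then have "measure \<mu> (dilate (t * R) (cball 0 1)) = 1 - measure \<mu> (?T R)"
    using prob_compl[of "?T R"] by simp
  ultimately have half: "measure \<mu> (?H v) \<le> measure \<mu> (?T R)"
    using t(1) by simp
  \<comment> \<open>Rotation invariance carries the bound for the one separating direction
    \<open>v\<close> to every normal in \<open>F\<close>.\<close>
  have "measure \<mu> (?H u) = measure \<mu> (?H v)" if "u \<in> F" for u
  proof -
    have "norm u = norm v" using F(2) that vw(1) by auto
    from emeasure_radial_measure_halfspace[OF increasing this] show ?thesis
      by (simp add: measure_def mu)
  qed
  then have "(\<Sum>u\<in>F. measure \<mu> (?H u)) = card F * measure \<mu> (?H v)"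
    by simp
  moreover have "measure \<mu> (?T a) \<le> measure \<mu> (\<Union>u\<in>F. ?H u)"
    using F \<open>0 < t\<close> by (intro finite_measure_mono) auto
  moreover have "measure \<mu> (\<Union>u\<in>F. ?H u) \<le> (\<Sum>u\<in>F. measure \<mu> (?H u))"
    using F by (intro finite_measure_subadditive_finite) auto
  ultimately have upper: "measure \<mu> (?T a) \<le> card F * measure \<mu> (?T R)"
    using mult_left_mono[OF half, of "card F"] by simp
  have "ennreal (measure \<mu> (?T R)) \<le> ennreal (s ^ DIM(real ^ 'n) * exp (- ln C)) * measure \<mu> (?T a)"
    using emeasure_radial_measure_tail_scale[OF increasing, of s "t * a" "ln C", where 'a = "real ^ 'n"]
      u0(2) s \<open>u0 \<le> t * a\<close>
    by (simp flip: emeasure_eq_measure mu add: mult.left_commute[of s])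
  moreover have "s ^ DIM(real ^ 'n) * exp (- ln C) = 1 / (real (card F) + 1)"
    using \<open>0 < C\<close> s(1) by (simp add: exp_minus C_def field_simps)
  ultimately have "ennreal (measure \<mu> (?T R))
      \<le> ennreal (1 / (real (card F) + 1)) * measure \<mu> (?T a)"
    by simp
  then have "measure \<mu> (?T R) \<le> 1 / (real (card F) + 1) * measure \<mu> (?T a)"
    by (simp flip: ennreal_mult)
  then have "measure \<mu> (?T R) * (real (card F) + 1) \<le> measure \<mu> (?T a)"
    by (simp add: field_simps)
  \<comment> \<open>With \<open>N = card F\<close> and \<open>m\<close> the measure of
    \<open>?T R\<close>, the two bounds give \<open>(N + 1) * m <= N * m\<close>, which forces
    \<open>m = 0\<close>.\<close>
  with upper have "measure \<mu> (?T R) = 0"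
    by (intro antisym) (simp_all add: algebra_simps)
  with upper have "measure \<mu> (?T a) \<le> 0"
    by simp
  moreover have "0 < measure \<mu> (?T a)"
    using emeasure_radial_measure_tail_pos[OF increasing, of "t * a", where 'a = "real ^ 'n"]
    by (simp flip: mu add: emeasure_eq_measure)
  ultimately show False
    by simp
qed

end
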